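(* Let $1<\alpha<2$. Then the density of the $\alpha$-Linnik variable $\Lambda_\alpha$, as well as the characteristic function of the $\alpha$-Cauchy variable $\mathcal{C}_\alpha$, is proportional (i.e. equal up to a positive multiplicative constant not depending on $x$), as a function of $x\in\mathbb{R}$, to $$ \int_0^\infty e^{-|x|y}\,\frac{y^\alpha}{y^{2\alpha}+2\cos(\pi\alpha/2)\,y^\alpha+1}\,dy . $$
   Context: For $0<\alpha\le 2$, the $\alpha$-Linnik variable $\Lambda_\alpha$ is the real random variable defined by its characteristic function $\mathbb{E}[e^{i\theta\Lambda_\alpha}]=\frac{1}{1+|\theta|^\alpha}$, $\theta\in\mathbb{R}$. For $\alpha>1$, the $\alpha$-Cauchy variable $\mathcal{C}_\alpha$ is a real random variable with density $f_{\mathcal{C}_\alpha}(x)=\frac{\sin(\pi/\alpha)}{2\pi/\alpha}\frac{1}{1+|x|^\alpha}$, $x\in\mathbb{R}$; its characteristic function is $x\mapsto\mathbb{E}[e^{ix\mathcal{C}_\alpha}]$. *)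

theory Defs
  imports "HOL-Probability.Probability"
begin

(* Meant for 0 < \<alpha> \<le> 2. *)
definition linnik_variable :: "real \<Rightarrow> 'a measure \<Rightarrow> ('a \<Rightarrow> real) \<Rightarrow> bool" where
  "linnik_variable \<alpha> M X \<longleftrightarrow>
     prob_space M \<and> X \<in> borel_measurable M \<and>
     (\<forall>\<theta>. char (distr M borel X) \<theta> = complex_of_real (1 / (1 + \<bar>\<theta>\<bar> powr \<alpha>)))"

(* Meant for \<alpha> > 1, where the density is integrable with total mass 1. *)
definition cauchy_density :: "real \<Rightarrow> real \<Rightarrow> real" where
  "cauchy_density \<alpha> x = sin (pi / \<alpha>) / (2 * pi / \<alpha>) * (1 / (1 + \<bar>x\<bar> powr \<alpha>))"

definition cauchy_variable :: "real \<Rightarrow> 'a measure \<Rightarrow> ('a \<Rightarrow> real) \<Rightarrow> bool" where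
  "cauchy_variable \<alpha> M X \<longleftrightarrow>
     prob_space M \<and> distributed M lborel X (\<lambda>x. ennreal (cauchy_density \<alpha> x))"

(* For 1 < \<alpha> < 2 the denominator is positive and the integral converges for every real x,
   including x = 0, so the value 0 assigned to divergent integrals never arises. *)
definition linnik_integral :: "real \<Rightarrow> real \<Rightarrow> real" where
  "linnik_integral \<alpha> x =
     (LINT y:{0..}|lborel. exp (- \<bar>x\<bar> * y) *
        (y powr \<alpha> / (y powr (2 * \<alpha>) + 2 * cos (pi * \<alpha> / 2) * y powr \<alpha> + 1)))"

end

(*
  Integrating exp (i x z) / (1 + z^\<alpha>) over the boundary of the first quadrant, where the principal
  branch of z^\<alpha> is continuous and 1 + z^\<alpha> has no zero (as \<alpha> < 2), moves the integral from the
  positive real axis to the positive imaginary axis. Taking real parts shows that the Fourier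
  transform of 1 / (1 + |t|^\<alpha>) is 2 sin (pi \<alpha> / 2) times the stated integral; up to normalisation
  this is the characteristic function of the \<alpha>-Cauchy variable. The characteristic function
  1 / (1 + |t|^\<alpha>) of the \<alpha>-Linnik variable is integrable because \<alpha> > 1, so by Levy inversion
  the same transform, divided by 2 pi, is its density.
*)
theory Submission
  imports Defs "HOL-Complex_Analysis.Complex_Analysis" "HOL-Real_Asymp.Real_Asymp"
begin

section \<open>Fourier inversion for integrable characteristic functions\<close>

context real_distribution
begin

text \<open>Levy inversion gives the mass as a limit of integrals over growing windows.
  Integrability of \<open>char M\<close> and the bounded kernel turn that limit into one integral
  over the line. The kernel is itself the integral of \<open>iexp (-(t * x))\<close> over
  \<open>x\<close> in \<open>{a..b}\<close>, so Fubini finishes.\<close>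

lemma measure_Ioc_eq_Fourier_integral:
  assumes int: "complex_integrable lborel (char M)"
    and ab: "a \<le> b" "measure M {a} = 0" "measure M {b} = 0"
  shows "complex_of_real (measure M {a<..b}) =
    (CLBINT x:{a..b}. 1 / (2 * pi) * (CLBINT t. iexp (-(t * x)) * char M t))"
proof -
  let ?F = "\<lambda>t. (iexp (-(t * a)) - iexp (-(t * b))) / (\<i> * t)"
  have [measurable]: "char M \<in> borel_measurable borel" by (rule char_measurable)
  \<comment> \<open>At \<open>t = 0\<close> the quotient is 0 by the convention for division by
    zero, and the bound reduces to \<open>a \<le> b\<close>.\<close>
  have Fb: "cmod (?F t) \<le> b - a" for t
    using Levy_Inversion_aux2[of "-b" "-a" t] ab by (cases "t = 0") (auto simp: norm_divide)
  have intF: "complex_integrable lborel (\<lambda>t. ?F t * char M t)"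
  proof (rule Bochner_Integration.integrable_bound)
    show "integrable lborel (\<lambda>t. (b - a) * cmod (char M t))"
      using int by auto
    show "AE t in lborel. cmod (?F t * char M t) \<le> norm ((b - a) * cmod (char M t))"
      unfolding norm_mult[of "?F _"] using Fb ab(1) by (intro AE_I2) (simp add: mult_right_mono del: of_real_mult)
  qed measurable
  have "(\<lambda>n. LBINT t. indicator {- real n<..<real n} t *\<^sub>R (?F t * char M t))
      \<longlonglongrightarrow> (LBINT t. ?F t * char M t)"
  proof (rule integral_dominated_convergence)
    show "integrable lborel (\<lambda>t. cmod (?F t * char M t))"
      using intF by (rule integrable_norm)
    show "AE t in lborel. (\<lambda>n. indicator {- real n<..<real n} t *\<^sub>R (?F t * char M t))
        \<longlonglongrightarrow> ?F t * char M t"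
    proof (intro AE_I2 tendsto_eventually)
      fix t :: real
      obtain N where N: "\<bar>t\<bar> < real N" using reals_Archimedean2 by blast
      show "\<forall>\<^sub>F n in sequentially. indicator {- real n<..<real n} t *\<^sub>R (?F t * char M t) = ?F t * char M t"
        using eventually_ge_at_top[of N] by eventually_elim (use N in \<open>auto simp: indicator_def\<close>)
    qed
    show "AE t in lborel. cmod (indicator {- real n<..<real n} t *\<^sub>R (?F t * char M t)) \<le> cmod (?F t * char M t)" for n
      by (intro AE_I2) (auto simp: indicator_def)
  qed measurable
  moreover have "(LBINT t. indicator {- real n<..<real n} t *\<^sub>R (?F t * char M t))
     = (CLBINT t=-real n..real n. ?F t * char M t)" for n
    by (simp add: interval_lebesgue_integral_def set_lebesgue_integral_def)
  ultimately have "(\<lambda>n. 1 / (2 * pi) * (CLBINT t=-real n..real n. ?F t * char M t))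
      \<longlonglongrightarrow> 1 / (2 * pi) * (LBINT t. ?F t * char M t)"
    by (intro tendsto_mult tendsto_const) simp
  moreover have "(\<lambda>n. 1 / (2 * pi) * (CLBINT t=-real n..real n. ?F t * char M t))
      \<longlonglongrightarrow> complex_of_real (measure M {a<..b})"
    using Levy_Inversion[OF ab] by (simp only: of_int_minus of_int_of_nat_eq)
  ultimately have "complex_of_real (measure M {a<..b}) = 1 / (2 * pi) * (CLBINT t. ?F t * char M t)"
    by (intro LIMSEQ_unique)
  also have "(CLBINT t. ?F t * char M t) =
      (CLBINT t. (CLBINT x. indicator {a..b} x *\<^sub>R (iexp (-(t * x)) * char M t)))"
  proof (rule integral_cong_AE)
    show "AE t in lborel. ?F t * char M t = (CLBINT x. indicator {a..b} x *\<^sub>R (iexp (-(t * x)) * char M t))"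
    \<comment> \<open>At \<open>t = 0\<close> the kernel has the value 0 instead of its limit
      \<open>b - a\<close>, so the identity is claimed off this null set.\<close>
    proof (rule AE_mp[OF AE_lborel_singleton[of 0]], intro AE_I2 impI)
      fix t :: real assume t: "t \<noteq> 0"
      let ?p = "\<lambda>x. - iexp (-(t * x)) / (\<i> * t) * char M t"
      have "(CLBINT x. indicator {a..b} x *\<^sub>R (iexp (-(t * x)) * char M t)) = ?p b - ?p a"
        using ab(1)
      proof (rule integral_FTC_atLeastAtMost)
        fix x
        have "((\<lambda>z. - exp (- (\<i> * t * z)) / (\<i> * t) * char M t) has_field_derivative
            exp (- (\<i> * t * of_real x)) * char M t) (at (of_real x))"
          using t by (auto intro!: derivative_eq_intros)
        from has_vector_derivative_real_field[OF this, of "{a..b}"]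
        show "(?p has_vector_derivative iexp (-(t * x)) * char M t) (at x within {a..b})"
          by (simp add: mult.assoc)
      qed (intro continuous_intros)
      also have "\<dots> = ?F t * char M t" using t by (simp add: field_simps)
      finally show "?F t * char M t = (CLBINT x. indicator {a..b} x *\<^sub>R (iexp (-(t * x)) * char M t))" ..
    qed
  qed measurable
  also have "\<dots> = (CLBINT x. (CLBINT t. indicator {a..b} x *\<^sub>R (iexp (-(t * x)) * char M t)))"
  proof (rule lborel_pair.Fubini_integral)
    have "integrable (lborel \<Otimes>\<^sub>M lborel) (\<lambda>(x,t). indicator {a..b} x * cmod (char M t))"
    proof (rule lborel_pair.Fubini_integrable)
      show "AE x in lborel. integrable lborel (\<lambda>t. case (x, t) of (x, t) \<Rightarrow> indicator {a..b} x * cmod (char M t))"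
        using int by auto
      show "integrable lborel (\<lambda>x. LBINT t. norm (case (x, t) of (x, t) \<Rightarrow> indicator {a..b} x * cmod (char M t)))"
        using borel_integrable_atLeastAtMost'[OF continuous_on_const, of a b "1::real"]
        by (simp add: abs_mult set_integrable_def)
    qed measurable
    then show "integrable (lborel \<Otimes>\<^sub>M lborel) (\<lambda>(x,t). indicator {a..b} x *\<^sub>R (iexp (-(t * x)) * char M t))"
      by (rule Bochner_Integration.integrable_bound) (auto simp: norm_mult split_beta')
  qed
  finally show ?thesis
    by (simp add: set_lebesgue_integral_def)
qed

text \<open>The preceding formula identifies the masses of half-open intervals whose endpoints are
  not atoms. Boundedness of \<open>f\<close> then excludes atoms altogether, so all half-open
  intervals are covered, and increasing unions of them give the rays that determine a finite
  measure.\<close>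

lemma density_eq_of_integrable_char:
  assumes int: "complex_integrable lborel (char M)"
    and f0: "\<And>x. 0 \<le> f x"
    and f: "\<And>x. complex_of_real (f x) = 1 / (2 * pi) * (CLBINT t. iexp (-(t * x)) * char M t)"
  shows "M = density lborel (\<lambda>x. ennreal (f x))"
proof -
  have [measurable]: "char M \<in> borel_measurable borel" by (rule char_measurable)
  \<comment> \<open>Measurability of \<open>f\<close> is read off from its formula as an integral
    with parameter \<open>x\<close>.\<close>
  have "f = (\<lambda>x. Re (1 / (2 * pi) * (CLBINT t. iexp (-(t * x)) * char M t)))"
    by (intro ext) (simp only: f[symmetric] Re_complex_of_real)
  then have [measurable]: "f \<in> borel_measurable borel" by simp
  define B where "B = 1 / (2 * pi) * (LBINT t. cmod (char M t))"
  have fB: "f x \<le> B" for x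
  proof -
    have "f x = cmod (complex_of_real (f x))" using f0 by simp
    also have "\<dots> = 1 / (2 * pi) * cmod (CLBINT t. iexp (-(t * x)) * char M t)"
      by (simp add: f norm_mult norm_divide)
    also have "\<dots> \<le> 1 / (2 * pi) * (LBINT t. cmod (iexp (-(t * x)) * char M t))"
      by (intro mult_left_mono integral_norm_bound) auto
    finally show ?thesis by (simp add: B_def norm_mult)
  qed
  have intf: "set_integrable lborel {a..b} f" for a b
    unfolding set_integrable_def
    by (rule integrableI_bounded_set_indicator[where B=B]) (use f0 fB in \<open>auto simp: emeasure_lborel_Icc_eq\<close>)
  have Ioc: "measure M {a<..b} = (LBINT x:{a..b}. f x)"
    if "a \<le> b" "measure M {a} = 0" "measure M {b} = 0" for a b
  proof -
    have "complex_of_real (measure M {a<..b}) = (CLBINT x:{a..b}. complex_of_real (f x))"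
      using measure_Ioc_eq_Fourier_integral[OF int that] by (simp only: f)
    also have "\<dots> = complex_of_real (LBINT x:{a..b}. f x)"
      by (rule set_integral_complex_of_real)
    finally show ?thesis by simp
  qed
  have atom: "measure M {x} = 0" for x
  proof (rule ccontr)
    assume "measure M {x} \<noteq> 0"
    then have pos: "measure M {x} > 0" by (simp add: zero_less_measure_iff)
    \<comment> \<open>Chosen so that \<open>2 * d * (\<bar>B\<bar> + 1)\<close> is the mass of the
      supposed atom, while an interval around \<open>x\<close> of length below \<open>2 * d\<close>
      has mass at most \<open>2 * d * \<bar>B\<bar>\<close>.\<close>
    define d where "d = measure M {x} / (2 * (\<bar>B\<bar> + 1))"
    have d: "d > 0" using pos by (simp add: d_def)
    \<comment> \<open>There are only countably many atoms, so endpoints free of mass exist on either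
      side of \<open>x\<close>, as close as desired.\<close>
    obtain a where a: "x - d < a" "a < x" "measure M {a} = 0"
      using open_minus_countable[OF countable_support, of "{x - d<..<x}"] d by auto
    obtain b where b: "x < b" "b < x + d" "measure M {b} = 0"
      using open_minus_countable[OF countable_support, of "{x<..<x + d}"] d by auto
    have "measure M {x} \<le> measure M {a<..b}"
      using a b by (intro finite_measure_mono) auto
    also have "\<dots> = (LBINT x:{a..b}. f x)" using a b by (intro Ioc) auto
    also have "\<dots> \<le> (LBINT x:{a..b}. B)"
      by (rule set_integral_mono) (use intf fB borel_integrable_atLeastAtMost'[OF continuous_on_const] in auto)
    also have "\<dots> = (b - a) * B" using a b by (simp add: set_lebesgue_integral_def)
    also have "\<dots> \<le> (2 * d) * \<bar>B\<bar>" using a b by (intro order_trans[OF mult_left_mono[OF abs_ge_self] mult_right_mono]) auto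
    also have "\<dots> < 2 * d * (\<bar>B\<bar> + 1)" using d by simp
    also have "\<dots> = measure M {x}" unfolding d_def by (simp add: field_simps)
    finally show False by simp
  qed
  let ?D = "density lborel (\<lambda>x. ennreal (f x))"
  have Ioc': "emeasure M {a<..b} = emeasure ?D {a<..b}" if "a \<le> b" for a b
  proof -
    have "emeasure ?D {a<..b} = (\<integral>\<^sup>+x. ennreal (f x) * indicator {a<..b} x \<partial>lborel)"
      by (simp add: emeasure_density)
    \<comment> \<open>The half-open and the closed interval differ only in the null set
      \<open>{a}\<close>.\<close>
    also have "\<dots> = (\<integral>\<^sup>+x. ennreal (indicator {a..b} x *\<^sub>R f x) \<partial>lborel)"
      by (rule nn_integral_cong_AE, rule AE_mp[OF AE_lborel_singleton[of a]], rule AE_I2)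
        (simp add: indicator_def)
    also have "\<dots> = ennreal (LBINT x:{a..b}. f x)"
      unfolding set_lebesgue_integral_def using intf[of a b] f0
      by (intro nn_integral_eq_integral) (auto simp: set_integrable_def)
    also have "\<dots> = emeasure M {a<..b}"
      using Ioc[OF that atom atom] by (simp add: emeasure_eq_measure)
    finally show ?thesis ..
  qed
  show ?thesis
  proof (rule measure_eqI_lessThan)
    fix x
    have "y \<in> (\<Union>n. {x<..x + real n})" if "x < y" for y
      using real_arch_simple[of "y - x"] that by (auto simp: diff_le_eq add.commute)
    then have U: "{x<..} = (\<Union>n. {x<..x + real n})" by auto
    have inc: "incseq (\<lambda>n. {x<..x + real n})" by (auto simp: incseq_def)
    show "emeasure M {x<..} = emeasure ?D {x<..}"
      unfolding U
      by (subst (1 2) SUP_emeasure_incseq[symmetric]) (use inc Ioc' in auto)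
    show "emeasure M {x<..} < \<infinity>" by (simp add: emeasure_eq_measure)
  qed auto
qed

end

section \<open>The integrand on the closed first quadrant\<close>

definition quadrant :: "complex set" where
  "quadrant = {z. 0 \<le> Re z \<and> 0 \<le> Im z}"

lemma convex_quadrant: "convex quadrant"
  by (auto simp: convex_def quadrant_def)

text \<open>A small shift to the left stays in the quadrant. The conclusion keeps interior points
  off the branch cut of the complex power.\<close>

lemma interior_quadrant: "z \<in> interior quadrant \<Longrightarrow> 0 < Re z"
proof -
  assume "z \<in> interior quadrant"
  then obtain e where e: "e > 0" "ball z e \<subseteq> quadrant" by (auto simp: mem_interior)
  have "z - of_real (e / 2) \<in> ball z e" using e(1) by (simp add: dist_norm del: of_real_divide)
  with e(2) have "z - of_real (e / 2) \<in> quadrant" by blast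
  with e(1) show ?thesis by (simp add: quadrant_def)
qed

lemma Arg_quadrant:
  assumes "z \<in> quadrant" "z \<noteq> 0"
  shows "0 \<le> Im (Ln z)" "Im (Ln z) \<le> pi / 2"
  using assms Im_Ln_pos_le[of z] Re_Ln_pos_le[of z] by (auto simp: quadrant_def)

text \<open>For \<open>z \<noteq> 0\<close> the argument of the power is \<open>a\<close> times a
  number in \<open>[0, pi / 2]\<close>, hence lies in \<open>[0, pi)\<close>, whereas -1 has
  argument \<open>pi\<close>.\<close>

lemma one_plus_powr_nonzero:
  assumes z: "z \<in> quadrant" and a: "0 < a" "a < 2"
  shows "1 + z powr complex_of_real a \<noteq> 0"
proof (cases "z = 0")
  case False
  let ?r = "Im (Ln z)"
  have r: "0 \<le> ?r" "?r \<le> pi / 2" using Arg_quadrant[OF z False] by auto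
  have "a * ?r \<le> a * (pi / 2)" using r a by (intro mult_left_mono) auto
  also have "\<dots> < pi" using a by simp
  finally have lt: "a * ?r < pi" .
  have eq: "z powr complex_of_real a = exp (of_real a * Ln z)" using False by (simp add: powr_def)
  show ?thesis
  proof
    assume 0: "1 + z powr complex_of_real a = 0"
    then have "z powr complex_of_real a = -1" by (metis add_eq_0_iff)
    then have "Im (exp (of_real a * Ln z)) = 0" "Re (exp (of_real a * Ln z)) = -1" by (simp_all add: eq)
    then have s: "sin (a * ?r) = 0" and c: "exp (a * Re (Ln z)) * cos (a * ?r) = -1"
      by (simp_all add: Im_exp Re_exp)
    \<comment> \<open>The sine is positive on the open interval from 0 to \<open>pi\<close>. With
      the angle 0, a positive exponential would have to equal -1.\<close>
    have "a * ?r = 0"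
      using s sin_gt_zero[of "a * ?r"] lt r a by (metis less_eq_real_def mult_nonneg_nonneg order_less_irrefl)
    with c show False by (simp add: not_less[symmetric]) (smt (verit) exp_gt_zero)
  qed
qed simp

lemma cmod_one_plus_powr_ge: "cmod z powr a - 1 \<le> cmod (1 + z powr complex_of_real a)"
proof -
  have "cmod (z powr complex_of_real a) = cmod z powr a"
    by (cases "z = 0") (simp_all add: powr_def)
  then show ?thesis
    using norm_triangle_ineq2[of "z powr complex_of_real a" "-1"] by (simp add: add.commute)
qed

text \<open>Both sides are the squared modulus of \<open>1 + u * cis \<theta>\<close>. For
  \<open>u = y powr a\<close> and \<open>\<theta> = pi * a / 2\<close> this is the denominator in
  \<open>linnik_integral\<close>.\<close>

lemma one_plus_polar_squared:
  fixes u \<theta> :: real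
  shows "(1 + u * cos \<theta>)\<^sup>2 + (u * sin \<theta>)\<^sup>2 = u\<^sup>2 + 2 * cos \<theta> * u + 1"
proof -
  have "(1 + u * cos \<theta>)\<^sup>2 + (u * sin \<theta>)\<^sup>2
      = u\<^sup>2 * ((sin \<theta>)\<^sup>2 + (cos \<theta>)\<^sup>2) + 2 * cos \<theta> * u + 1"
    by algebra
  then show ?thesis by simp
qed

text \<open>The squares of the two sides differ by
  \<open>(1 - cos \<theta>) / 2 * (1 - u)\<^sup>2\<close>. The bound makes the integrand on the
  imaginary axis comparable to the one on the real axis.\<close>

lemma cmod_one_plus_cis_ge:
  assumes "0 \<le> u"
  shows "sqrt ((1 + cos \<theta>) / 2) * (1 + u) \<le> cmod (1 + of_real u * cis \<theta>)"
proof (rule power2_le_imp_le)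
  let ?c = "cos \<theta>"
  have "0 \<le> (1 + ?c) / 2" using add_left_mono[OF cos_ge_minus_one[of \<theta>], of 1] by simp
  then have "(sqrt ((1 + ?c) / 2) * (1 + u))\<^sup>2 = (1 + ?c) / 2 * (1 + u)\<^sup>2"
    by (simp only: power_mult_distrib real_sqrt_pow2)
  also have "\<dots> = (1 + 2 * ?c * u + u\<^sup>2) - (1 - ?c) / 2 * (1 - u)\<^sup>2"
    by (simp add: power2_eq_square field_simps)
  also have "\<dots> \<le> 1 + 2 * ?c * u + u\<^sup>2" by simp
  also have "\<dots> = (cmod (1 + of_real u * cis \<theta>))\<^sup>2"
    unfolding cmod_power2 by (simp add: one_plus_polar_squared)
  finally show "(sqrt ((1 + ?c) / 2) * (1 + u))\<^sup>2 \<le> (cmod (1 + of_real u * cis \<theta>))\<^sup>2" .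
qed auto

lemma imaginary_powr:
  assumes "0 \<le> y"
  shows "(\<i> * of_real y) powr complex_of_real a = of_real (y powr a) * cis (pi * a / 2)"
proof (cases "y = 0")
  case False
  then have y: "y > 0" using assms by simp
  have "Ln (\<i> * of_real y) = of_real (ln y) + \<i> * (pi / 2)"
    using y Ln_times_of_real[of y \<i>] by (simp add: Ln_of_real mult.commute)
  then show ?thesis using y
    by (simp add: powr_def exp_add[symmetric] exp_of_real[symmetric] cis_conv_exp algebra_simps)
qed simp

section \<open>Rotation of the contour from the real to the imaginary half-axis\<close>

lemma set_integrable_one_over_one_plus_powr:
  fixes a :: real
  assumes "1 < a"
  shows "set_integrable lborel {0..} (\<lambda>t. 1 / (1 + t powr a))"
proof -
  have "set_integrable lborel {0..1} (\<lambda>t. 1 / (1 + t powr a))"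
    unfolding set_integrable_def
    by (rule integrableI_bounded_set_indicator[where B=1]) (auto simp: field_simps add_pos_nonneg)
  moreover have "set_integrable lborel {1..} (\<lambda>t. 1 / (1 + t powr a))"
  proof (rule set_integrable_bound)
    \<comment> \<open>The explicit gauge integral on the ray becomes an absolute one by
      nonnegativity, and then passes from the completed measure to \<open>lborel\<close>.\<close>
    have "(\<lambda>t. t powr -a) absolutely_integrable_on {1..}"
      using has_integral_powr_to_inf[of "-a" 1] assms
      by (intro nonnegative_absolutely_integrable) (auto simp: integrable_on_def)
    then show "set_integrable lborel {1..} (\<lambda>t. t powr -a)"
      by (simp add: set_integrable_def integrable_completion)
    show "AE t in lborel. t \<in> {1..} \<longrightarrow> norm (1 / (1 + t powr a)) \<le> norm (t powr -a)"
      by (intro AE_I2) (auto simp: powr_minus field_simps add_pos_nonneg)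
  qed (auto simp: set_borel_measurable_def)
  ultimately have "set_integrable lborel ({0..1} \<union> {1..}) (\<lambda>t. 1 / (1 + t powr a))"
    by (rule set_integrable_Un) auto
  moreover have "{0..1} \<union> {1..} = {0::real..}" by auto
  ultimately show ?thesis by simp
qed

lemma set_integral_at_top:
  fixes f :: "real \<Rightarrow> complex"
  assumes "set_integrable lborel {0..} f"
  shows "((\<lambda>R. LBINT t. indicator {0..R} t *\<^sub>R f t) \<longlongrightarrow> (CLBINT t:{0..}. f t)) at_top"
proof -
  have "indicator {..R} t *\<^sub>R indicator {0..} t *\<^sub>R f t = indicator {0..R} t *\<^sub>R f t" for R t
    by (auto simp: indicator_def)
  then show ?thesis
    using tendsto_integral_at_top[OF sets_lborel assms[unfolded set_integrable_def]]
    by (simp only: set_lebesgue_integral_def)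
qed

text \<open>A primitive \<open>g\<close> on the quadrant turns the two truncated integrals into
  \<open>g R - g 0\<close> and \<open>g (\<i> * R) - g 0\<close>. It remains to show that
  \<open>g R - g (\<i> * R)\<close> tends to 0.\<close>

lemma rotate_contour:
  fixes a x :: real
  assumes a: "1 < a" "a < 2" and x: "0 \<le> x"
  defines "f \<equiv> (\<lambda>z. exp (\<i> * of_real x * z) / (1 + z powr complex_of_real a))"
  shows "set_integrable lborel {0..} (\<lambda>t. f (of_real t))"
    and "set_integrable lborel {0..} (\<lambda>y. \<i> * f (\<i> * of_real y))"
    and "(CLBINT t:{0..}. f (of_real t)) = (CLBINT y:{0..}. \<i> * f (\<i> * of_real y))"
proof -
  note h = set_integrable_one_over_one_plus_powr[OF a(1)]
  have nz: "1 + z powr complex_of_real a \<noteq> 0" if "z \<in> quadrant" for z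
    using that a by (intro one_plus_powr_nonzero) auto
  have contf: "continuous_on quadrant f"
    unfolding f_def using nz a by (intro continuous_intros) (auto simp: quadrant_def)
  have fd: "f field_differentiable at z" if "z \<in> interior quadrant" for z
  proof -
    have "z \<notin> \<real>\<^sub>\<le>\<^sub>0" using interior_quadrant[OF that] by (auto simp: complex_nonpos_Reals_iff)
    moreover have "1 + z powr complex_of_real a \<noteq> 0" using that interior_subset nz by blast
    ultimately show ?thesis
      unfolding f_def field_differentiable_def by (auto intro!: exI derivative_eq_intros)
  qed
  \<comment> \<open>The primitive theorem asks for continuity on the convex set and
    differentiability in its interior. The branch point 0 lies on the boundary, so it is covered by
    continuity.\<close>
  obtain g where g: "\<And>z. z \<in> quadrant \<Longrightarrow> (g has_field_derivative f z) (at z within quadrant)"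
    using holomorphic_convex_primitive[OF convex_quadrant finite.emptyI contf] fd by auto
  have real: "complex_of_real t \<in> quadrant" "\<i> * complex_of_real t \<in> quadrant" if "0 \<le> t" for t
    using that by (auto simp: quadrant_def)
  have ray: "(LBINT t. indicator {0..R} t *\<^sub>R (w * f (w * of_real t))) = g (w * of_real R) - g 0"
    if R: "0 \<le> R" and w: "\<And>t. 0 \<le> t \<Longrightarrow> w * complex_of_real t \<in> quadrant" for w R
  proof -
    have "(LBINT t. indicator {0..R} t *\<^sub>R (w * f (w * of_real t)))
       = (\<lambda>t. g (w * of_real t)) R - (\<lambda>t. g (w * of_real t)) 0"
      using R
    proof (rule integral_FTC_atLeastAtMost)
      fix t assume t: "0 \<le> t" "t \<le> R"
      have "((\<lambda>t. w * of_real t) has_vector_derivative w) (at t within {0..R})"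
        by (auto intro!: derivative_eq_intros simp: has_vector_derivative_def scaleR_conv_of_real)
      moreover have "(g has_field_derivative f (w * of_real t)) (at (w * of_real t) within (\<lambda>t. w * of_real t) ` {0..R})"
        by (rule DERIV_subset[OF g]) (use t w in auto)
      ultimately show "((\<lambda>t. g (w * of_real t)) has_vector_derivative w * f (w * of_real t)) (at t within {0..R})"
        using field_vector_diff_chain_within by (fastforce simp: o_def)
    next
      show "continuous_on {0..R} (\<lambda>t. w * f (w * of_real t))"
        by (intro continuous_intros continuous_on_compose2[OF contf]) (use w in auto)
    qed
    then show ?thesis by simp
  qed
  have meas: "set_borel_measurable lborel {0..} (\<lambda>t. w * f (w * of_real t))"
    if w: "\<And>t. 0 \<le> t \<Longrightarrow> w * complex_of_real t \<in> quadrant" for w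
    unfolding set_borel_measurable_def measurable_lborel2 measurable_lborel1
    by (rule borel_measurable_continuous_on_indicator, simp, intro continuous_intros continuous_on_compose2[OF contf])
       (use w in auto)
  show 1: "set_integrable lborel {0..} (\<lambda>t. f (of_real t))"
  proof (rule set_integrable_bound[OF h])
    show "set_borel_measurable lborel {0..} (\<lambda>t. f (of_real t))" using meas[of 1] real by simp
    have "cmod (1 + complex_of_real (t powr a)) = 1 + t powr a" for t
      by (metis abs_of_nonneg add_nonneg_nonneg norm_of_real of_real_1 of_real_add powr_ge_zero zero_le_one)
    then show "AE t in lborel. t \<in> {0..} \<longrightarrow> cmod (f (of_real t)) \<le> norm (1 / (1 + t powr a))"
      unfolding f_def by (intro AE_I2) (auto simp: norm_divide powr_of_real)
  qed
  \<comment> \<open>The constant of \<open>cmod_one_plus_cis_ge\<close> at the angle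
    \<open>pi * a / 2\<close>; it is positive because this angle is below \<open>pi\<close>.\<close>
  let ?k = "sqrt ((1 + cos (pi * a / 2)) / 2)"
  have "cos (pi * a / 2) > cos pi" using a by (intro cos_monotone_0_pi) auto
  then have k: "?k > 0" by simp
  show 2: "set_integrable lborel {0..} (\<lambda>y. \<i> * f (\<i> * of_real y))"
  proof (rule set_integrable_bound)
    show "set_integrable lborel {0..} (\<lambda>t. 1 / ?k * (1 / (1 + t powr a)))"
      using h by (rule set_integrable_mult_right)
    show "set_borel_measurable lborel {0..} (\<lambda>y. \<i> * f (\<i> * of_real y))"
      using meas[of \<i>] real by simp
    show "AE y in lborel. y \<in> {0..} \<longrightarrow> cmod (\<i> * f (\<i> * of_real y)) \<le> norm (1 / ?k * (1 / (1 + y powr a)))"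
    proof (intro AE_I2 impI)
      fix y :: real assume "y \<in> {0..}"
      then have y: "0 \<le> y" by simp
      have "cmod (\<i> * f (\<i> * of_real y)) = exp (- x * y) / cmod (1 + of_real (y powr a) * cis (pi * a / 2))"
        by (simp add: f_def norm_mult norm_divide imaginary_powr[OF y])
      also have "\<dots> \<le> 1 / (?k * (1 + y powr a))"
        using x y k cmod_one_plus_cis_ge[of "y powr a" "pi * a / 2"]
        by (intro frac_le) (auto intro!: mult_pos_pos add_pos_nonneg)
      finally show "cmod (\<i> * f (\<i> * of_real y)) \<le> norm (1 / ?k * (1 / (1 + y powr a)))"
        using k by (simp add: abs_mult)
    qed
  qed
  \<comment> \<open>The chord \<open>Re z + Im z = R\<close> serves instead of a quarter circle: it lies in the convex quadrant,
    so the mean value bound for the primitive suffices, and no Jordan lemma is needed since \<open>a > 1\<close>.\<close>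
  have bound: "cmod (g (of_real R) - g (\<i> * of_real R)) \<le> 1 / ((R / 2) powr a - 1) * (2 * R)" if R: "R > 2" for R
  proof -
    let ?S = "{z \<in> quadrant. Re z + Im z = R}"
    have gt: "(R / 2) powr a > 1" using R a by (intro gr_one_powr) auto
    have "cmod (g (of_real R) - g (\<i> * of_real R)) \<le> 1 / ((R / 2) powr a - 1) * cmod (of_real R - \<i> * of_real R)"
    proof (rule field_differentiable_bound[where S="?S"])
      have "convex {z. Re z + Im z = R}"
        by (auto simp: convex_def algebra_simps) (metis distrib_left distrib_right mult_1_left add.assoc add.left_commute)
      from convex_Int[OF convex_quadrant this] show "convex ?S" by (simp add: Int_def)
      fix z assume z: "z \<in> ?S"
      then show "(g has_field_derivative f z) (at z within ?S)"
        by (intro DERIV_subset[OF g]) auto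
      \<comment> \<open>Both coordinates are at most \<open>cmod z\<close>, and they add up to
        \<open>R\<close>.\<close>
      have "R / 2 \<le> cmod z"
        using z complex_Re_le_cmod[of z] abs_Im_le_cmod[of z] by auto
      then have "(R / 2) powr a \<le> cmod z powr a" using R a by (intro powr_mono2) auto
      then have "(R / 2) powr a - 1 \<le> cmod (1 + z powr complex_of_real a)"
        using cmod_one_plus_powr_ge[of z a] by linarith
      \<comment> \<open>The numerator has modulus \<open>exp (- x * Im z)\<close>, at most 1 since
        \<open>x\<close> and \<open>Im z\<close> are nonnegative.\<close>
      then show "cmod (f z) \<le> 1 / ((R / 2) powr a - 1)"
        unfolding f_def norm_divide using gt z x by (intro frac_le) (auto simp: quadrant_def)
    qed (use R in \<open>auto simp: quadrant_def\<close>)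
    also have "cmod (of_real R - \<i> * of_real R) \<le> 2 * R"
      using R norm_triangle_ineq4[of "complex_of_real R" "\<i> * of_real R"] by (simp add: norm_mult)
    finally show ?thesis using gt by (simp add: divide_right_mono mult_left_mono)
  qed
  have "((\<lambda>R. g (of_real R) - g (\<i> * of_real R)) \<longlongrightarrow> 0) at_top"
  proof (rule Lim_null_comparison)
    show "\<forall>\<^sub>F R in at_top. cmod (g (of_real R) - g (\<i> * of_real R)) \<le> 1 / ((R / 2) powr a - 1) * (2 * R)"
      using eventually_gt_at_top[of 2] by eventually_elim (rule bound)
    \<comment> \<open>The bound has order \<open>R powr (1 - a)\<close>, which vanishes at infinity
      because \<open>a > 1\<close>.\<close>
    show "((\<lambda>R::real. 1 / ((R / 2) powr a - 1) * (2 * R)) \<longlongrightarrow> 0) at_top"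
      using a by real_asymp
  qed
  moreover have "((\<lambda>R. g (of_real R) - g (\<i> * of_real R)) \<longlongrightarrow>
      (CLBINT t:{0..}. f (of_real t)) - (CLBINT y:{0..}. \<i> * f (\<i> * of_real y))) at_top"
  proof (rule Lim_transform_eventually)
    show "((\<lambda>R. (LBINT t. indicator {0..R} t *\<^sub>R f (of_real t)) - (LBINT y. indicator {0..R} y *\<^sub>R (\<i> * f (\<i> * of_real y))))
      \<longlongrightarrow> (CLBINT t:{0..}. f (of_real t)) - (CLBINT y:{0..}. \<i> * f (\<i> * of_real y))) at_top"
      using set_integral_at_top[OF 1] set_integral_at_top[OF 2] by (rule tendsto_diff)
    show "\<forall>\<^sub>F R in at_top. (LBINT t. indicator {0..R} t *\<^sub>R f (of_real t)) - (LBINT y. indicator {0..R} y *\<^sub>R (\<i> * f (\<i> * of_real y)))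
       = g (of_real R) - g (\<i> * of_real R)"
      using eventually_ge_at_top[of 0]
      by eventually_elim (use ray[of _ 1] ray[of _ \<i>] real in auto)
  qed
  ultimately show "(CLBINT t:{0..}. f (of_real t)) = (CLBINT y:{0..}. \<i> * f (\<i> * of_real y))"
    using tendsto_unique[OF trivial_limit_at_top_linorder] by fastforce
qed

section \<open>The Fourier transform of \<open>1 / (1 + \<bar>t\<bar> powr a)\<close>\<close>

lemma linnik_denominator_pos:
  fixes a u :: real
  assumes a: "0 < a" "a < 2"
  shows "0 < u\<^sup>2 + 2 * cos (pi * a / 2) * u + 1"
proof (cases "u = 0")
  case False
  have "0 < sin (pi * a / 2)" using a by (intro sin_gt_zero) auto
  with False have "0 < (1 + u * cos (pi * a / 2))\<^sup>2 + (u * sin (pi * a / 2))\<^sup>2"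
    by (intro add_nonneg_pos) auto
  then show ?thesis by (simp only: one_plus_polar_squared)
qed simp

lemma linnik_integral_nonneg:
  assumes "0 < \<alpha>" "\<alpha> < 2"
  shows "0 \<le> linnik_integral \<alpha> x"
  unfolding linnik_integral_def set_lebesgue_integral_def
proof (rule Bochner_Integration.integral_nonneg)
  fix y
  have "0 < y powr (2 * \<alpha>) + 2 * cos (pi * \<alpha> / 2) * y powr \<alpha> + 1"
    using linnik_denominator_pos[OF assms, of "y powr \<alpha>"]
    by (simp only: power2_eq_square powr_add[symmetric] mult_2)
  then show "0 \<le> indicator {0..} y *\<^sub>R (exp (- \<bar>x\<bar> * y) * (y powr \<alpha> / (y powr (2 * \<alpha>) + 2 * cos (pi * \<alpha> / 2) * y powr \<alpha> + 1)))"
    by simp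
qed

text \<open>Expanding the fraction by the conjugate of its denominator leaves
  \<open>\<i> * (1 + u * cis (- \<theta>))\<close> with \<open>u = y powr a\<close> and
  \<open>\<theta> = pi * a / 2\<close>. Its real part \<open>u * sin \<theta>\<close> is the source
  of the factor \<open>sin (pi * a / 2)\<close>.\<close>

lemma Re_rotated_integrand:
  assumes y: "0 \<le> y"
  shows "Re (\<i> * (exp (\<i> * of_real x * (\<i> * of_real y)) / (1 + (\<i> * of_real y) powr complex_of_real a)))
    = sin (pi * a / 2) * (exp (- x * y) * (y powr a / (y powr (2 * a) + 2 * cos (pi * a / 2) * y powr a + 1)))"
proof -
  let ?u = "y powr a" and ?s = "sin (pi * a / 2)" and ?c = "cos (pi * a / 2)"
  have "\<i> * complex_of_real x * (\<i> * of_real y) = of_real (- x * y)" by (simp add: complex_eq_iff)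
  then have e: "exp (\<i> * of_real x * (\<i> * of_real y)) = complex_of_real (exp (- x * y))"
    by (simp only: exp_of_real)
  have "?u\<^sup>2 = y powr (2 * a)" by (simp only: power2_eq_square powr_add[symmetric] mult_2)
  then have d: "(1 + ?u * ?c)\<^sup>2 + (?u * ?s)\<^sup>2 = y powr (2 * a) + 2 * ?c * ?u + 1"
    by (simp only: one_plus_polar_squared)
  show ?thesis
    unfolding e imaginary_powr[OF y] by (simp add: Re_divide Im_divide d)
qed

lemma has_bochner_integral_Fourier_one_over_one_plus_powr:
  assumes a: "1 < a" "a < 2"
  shows "has_bochner_integral lborel (\<lambda>t. iexp (t * x) * complex_of_real (1 / (1 + \<bar>t\<bar> powr a)))
    (complex_of_real (2 * sin (pi * a / 2) * linnik_integral a x))"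
proof -
  \<comment> \<open>The frequency is \<open>\<bar>x\<bar>\<close>, since the rotation requires a
    nonnegative one; the sign of \<open>x\<close> is restored at the end.\<close>
  define f where "f = (\<lambda>z. exp (\<i> * of_real \<bar>x\<bar> * z) / (1 + z powr complex_of_real a))"
  define h where "h = (\<lambda>t::real. 1 / (1 + \<bar>t\<bar> powr a))"
  let ?V = "sin (pi * a / 2) * linnik_integral a x"
  have rot: "set_integrable lborel {0..} (\<lambda>t. f (of_real t))"
    "set_integrable lborel {0..} (\<lambda>y. \<i> * f (\<i> * of_real y))"
    "(CLBINT t:{0..}. f (of_real t)) = (CLBINT y:{0..}. \<i> * f (\<i> * of_real y))"
    unfolding f_def by (rule rotate_contour[OF a abs_ge_zero])+
  define J where "J = (CLBINT t:{0..}. f (of_real t))"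
  have J_def': "J = (CLBINT y:{0..}. \<i> * f (\<i> * of_real y))" by (simp only: J_def rot(3))
  have J: "has_bochner_integral lborel (\<lambda>t. indicator {0..} t *\<^sub>R f (of_real t)) J"
    using rot(1) unfolding J_def set_integrable_def set_lebesgue_integral_def by (rule has_bochner_integral_integrable)
  have "has_bochner_integral lborel (\<lambda>y. indicator {0..} y *\<^sub>R (\<i> * f (\<i> * of_real y))) J"
    using rot(2) unfolding J_def' set_integrable_def set_lebesgue_integral_def by (rule has_bochner_integral_integrable)
  from has_bochner_integral_integral_eq[OF has_bochner_integral_bounded_linear[OF bounded_linear_Re this]]
  have "Re J = (LBINT y. Re (indicator {0..} y *\<^sub>R (\<i> * f (\<i> * of_real y))))" ..
  also have "\<dots> = (LBINT y. sin (pi * a / 2) * (indicator {0..} y *\<^sub>R (exp (- \<bar>x\<bar> * y) *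
        (y powr a / (y powr (2 * a) + 2 * cos (pi * a / 2) * y powr a + 1)))))"
  proof (intro Bochner_Integration.integral_cong refl)
    fix y :: real
    show "Re (indicator {0..} y *\<^sub>R (\<i> * f (\<i> * of_real y))) = sin (pi * a / 2) * (indicator {0..} y *\<^sub>R (exp (- \<bar>x\<bar> * y) *
        (y powr a / (y powr (2 * a) + 2 * cos (pi * a / 2) * y powr a + 1))))"
    proof (cases "0 \<le> y")
      case True
      from Re_rotated_integrand[OF this, of "\<bar>x\<bar>" a] True show ?thesis
        by (simp only: f_def indicator_simps atLeast_iff scaleR_one)
    qed simp
  qed
  also have "\<dots> = ?V"
    unfolding linnik_integral_def set_lebesgue_integral_def by (rule integral_mult_right_zero)
  finally have Re_J: "Re J = ?V" .
  have Re_f: "Re (indicator {0..} t *\<^sub>R f (of_real t)) = indicator {0..} t *\<^sub>R (cos (\<bar>x\<bar> * t) * h t)"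
   and Im_f: "Im (indicator {0..} t *\<^sub>R f (of_real t)) = indicator {0..} t *\<^sub>R (sin (\<bar>x\<bar> * t) * h t)" for t
  proof -
    have "f (of_real t) = cis (\<bar>x\<bar> * t) * of_real (h t)" if "0 \<le> t"
      using that by (simp add: f_def h_def cis_conv_exp powr_of_real mult.assoc)
    then show "Re (indicator {0..} t *\<^sub>R f (of_real t)) = indicator {0..} t *\<^sub>R (cos (\<bar>x\<bar> * t) * h t)"
      and "Im (indicator {0..} t *\<^sub>R f (of_real t)) = indicator {0..} t *\<^sub>R (sin (\<bar>x\<bar> * t) * h t)"
      by (cases "0 \<le> t"; simp)+
  qed
  \<comment> \<open>As \<open>h\<close> is even, the cosine part doubles the half-line integral and
    the sine part cancels over the whole line.\<close>
  have "has_bochner_integral lborel (\<lambda>t. cos (\<bar>x\<bar> * t) * h t) (2 *\<^sub>R Re J)"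
    using has_bochner_integral_bounded_linear[OF bounded_linear_Re J]
    unfolding Re_f by (rule has_bochner_integral_even_function) (simp add: h_def)
  moreover have "has_bochner_integral lborel (\<lambda>t. sin (\<bar>x\<bar> * t) * h t) 0"
    using has_bochner_integral_bounded_linear[OF bounded_linear_Im J]
    unfolding Im_f by (rule has_bochner_integral_odd_function) (simp add: h_def)
  \<comment> \<open>The factor \<open>sgn x\<close> turns \<open>sin (\<bar>x\<bar> * t)\<close>
    into \<open>sin (t * x)\<close>, also for \<open>x = 0\<close>, where both vanish.\<close>
  ultimately have *: "has_bochner_integral lborel
     (\<lambda>t. complex_of_real (cos (\<bar>x\<bar> * t) * h t) + \<i> * of_real (sgn x) * of_real (sin (\<bar>x\<bar> * t) * h t))
     (of_real (2 *\<^sub>R Re J) + \<i> * of_real (sgn x) * of_real 0)"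
    by (intro has_bochner_integral_add has_bochner_integral_mult_right
        has_bochner_integral_bounded_linear[OF bounded_linear_of_real])
  have eq: "complex_of_real (cos (\<bar>x\<bar> * t) * h t) + \<i> * of_real (sgn x) * of_real (sin (\<bar>x\<bar> * t) * h t)
      = iexp (t * x) * complex_of_real (h t)" for t
  proof -
    have "cos (\<bar>x\<bar> * t) = cos (t * x)" "sgn x * sin (\<bar>x\<bar> * t) = sin (t * x)"
      by (auto simp: abs_real_def sgn_real_def mult.commute)
    moreover have "\<i> * of_real (sgn x) * of_real (sin (\<bar>x\<bar> * t) * h t) = \<i> * of_real (sgn x * sin (\<bar>x\<bar> * t)) * of_real (h t)"
      by (simp only: of_real_mult mult.assoc)
    ultimately show ?thesis
      by (simp only: cis_conv_exp[symmetric]) (simp add: complex_eq_iff)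
  qed
  show ?thesis
    using * unfolding eq by (simp add: Re_J h_def mult.assoc)
qed

section \<open>The Linnik density and the Cauchy characteristic function\<close>

lemma distributed_linnik:
  assumes a: "1 < \<alpha>" "\<alpha> < 2" and X: "linnik_variable \<alpha> M X"
  shows "distributed M lborel X (\<lambda>x. ennreal (sin (pi * \<alpha> / 2) / pi * linnik_integral \<alpha> x))"
proof -
  interpret prob_space M using X by (simp add: linnik_variable_def)
  have [measurable]: "X \<in> borel_measurable M" using X by (simp add: linnik_variable_def)
  have ch: "char (distr M borel X) = (\<lambda>t. complex_of_real (1 / (1 + \<bar>t\<bar> powr \<alpha>)))"
    using X by (auto simp: linnik_variable_def fun_eq_iff)
  interpret D: real_distribution "distr M borel X" by (rule real_distribution_distr) simp
  note F = has_bochner_integral_Fourier_one_over_one_plus_powr[OF a]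
  let ?f = "\<lambda>x. sin (pi * \<alpha> / 2) / pi * linnik_integral \<alpha> x"
  have s: "0 < sin (pi * \<alpha> / 2)" using a by (intro sin_gt_zero) auto
  have eq: "distr M borel X = density lborel (\<lambda>x. ennreal (?f x))"
  proof (rule D.density_eq_of_integrable_char)
    show "complex_integrable lborel (char (distr M borel X))"
      \<comment> \<open>At frequency 0 the exponential is 1, so the transform formula contains the
        integrability of the characteristic function.\<close>
      using F[of 0] by (simp add: ch has_bochner_integral_iff)
    show "0 \<le> ?f x" for x using s a linnik_integral_nonneg[of \<alpha> x] by simp
    show "complex_of_real (?f x) = 1 / (2 * pi) * (CLBINT t. iexp (-(t * x)) * char (distr M borel X) t)" for x
      \<comment> \<open>Inversion uses the opposite sign in the exponent;
        \<open>linnik_integral\<close> depends on \<open>x\<close> only through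
        \<open>\<bar>x\<bar>\<close>.\<close>
      using has_bochner_integral_integral_eq[OF F[of "- x"]]
      by (simp add: ch linnik_integral_def)
  qed
  have "?f \<in> borel_measurable borel"
    unfolding linnik_integral_def set_lebesgue_integral_def by measurable
  moreover have "distr M lborel X = distr M borel X" by (intro distr_cong) auto
  ultimately show ?thesis
    by (simp add: distributed_def eq)
qed

lemma cauchy_factor_pos:
  fixes \<alpha> :: real
  assumes "1 < \<alpha>"
  shows "0 < sin (pi / \<alpha>) / (2 * pi / \<alpha>)"
proof -
  have "pi / \<alpha> < pi" using assms by (simp add: pos_divide_less_eq)
  with assms have "0 < sin (pi / \<alpha>)" by (intro sin_gt_zero) simp_all
  with assms show ?thesis by (intro divide_pos_pos) simp_all
qed
lemma char_cauchy:
  assumes a: "1 < \<alpha>" "\<alpha> < 2" and X: "cauchy_variable \<alpha> M X"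
  shows "char (distr M borel X) x = complex_of_real
    (sin (pi / \<alpha>) / (2 * pi / \<alpha>) * (2 * sin (pi * \<alpha> / 2)) * linnik_integral \<alpha> x)"
proof -
  let ?k = "sin (pi / \<alpha>) / (2 * pi / \<alpha>)"
  have pos: "0 \<le> cauchy_density \<alpha> t" for t
    unfolding cauchy_density_def using cauchy_factor_pos[OF a(1)] by (intro mult_nonneg_nonneg) simp_all
  have m: "cauchy_density \<alpha> \<in> borel_measurable borel"
    unfolding cauchy_density_def by measurable
  have "distr M borel X = distr M lborel X" by (intro distr_cong) auto
  also have "\<dots> = density lborel (\<lambda>x. ennreal (cauchy_density \<alpha> x))"
    using X by (simp add: cauchy_variable_def distributed_def)
  finally have D: "distr M borel X = density lborel (\<lambda>x. ennreal (cauchy_density \<alpha> x))" .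
  have "char (distr M borel X) x = (CLBINT t. cauchy_density \<alpha> t *\<^sub>R iexp (x * t))"
    unfolding char_def D by (rule integral_density) (use pos in \<open>auto intro: m\<close>)
  also have "\<dots> = (CLBINT t. of_real ?k * (iexp (t * x) * complex_of_real (1 / (1 + \<bar>t\<bar> powr \<alpha>))))"
    unfolding cauchy_density_def scaleR_conv_of_real of_real_mult by (simp only: mult_ac)
  also have "\<dots> = of_real ?k * complex_of_real (2 * sin (pi * \<alpha> / 2) * linnik_integral \<alpha> x)"
    unfolding integral_mult_right_zero
    by (simp only: has_bochner_integral_integral_eq[OF has_bochner_integral_Fourier_one_over_one_plus_powr[OF a]])
  finally show ?thesis by (simp only: of_real_mult mult.assoc)
qed

theorem lemma2p7:
  fixes \<alpha> :: real
  assumes "1 < \<alpha>" and "\<alpha> < 2"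
  shows "(\<exists>c>0. \<forall>(M :: 'a measure) \<Lambda>. linnik_variable \<alpha> M \<Lambda> \<longrightarrow>
            distributed M lborel \<Lambda> (\<lambda>x. ennreal (c * linnik_integral \<alpha> x))) \<and>
         (\<exists>c>0. \<forall>(M :: 'b measure) C. cauchy_variable \<alpha> M C \<longrightarrow>
            (\<forall>x. char (distr M borel C) x = complex_of_real (c * linnik_integral \<alpha> x)))"
proof (rule conjI)
  have s: "0 < sin (pi * \<alpha> / 2)" using assms by (intro sin_gt_zero) auto
  show "\<exists>c>0. \<forall>(M :: 'a measure) \<Lambda>. linnik_variable \<alpha> M \<Lambda> \<longrightarrow>
            distributed M lborel \<Lambda> (\<lambda>x. ennreal (c * linnik_integral \<alpha> x))"
    \<comment> \<open>The witness is the factor \<open>2 * sin (pi * \<alpha> / 2)\<close> of the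
      transform divided by the \<open>2 * pi\<close> of the inversion formula.\<close>
    using s by (intro exI[of _ "sin (pi * \<alpha> / 2) / pi"] conjI allI impI distributed_linnik[OF assms]) simp_all
  \<comment> \<open>Here the constant is the normalisation of the Cauchy density times the factor of
    the transform.\<close>
  have "0 < sin (pi / \<alpha>) / (2 * pi / \<alpha>) * (2 * sin (pi * \<alpha> / 2))"
    using cauchy_factor_pos[OF assms(1)] s by (intro mult_pos_pos) simp_all
  then show "\<exists>c>0. \<forall>(M :: 'b measure) C. cauchy_variable \<alpha> M C \<longrightarrow>
            (\<forall>x. char (distr M borel C) x = complex_of_real (c * linnik_integral \<alpha> x))"
    using char_cauchy[OF assms] by blast
qed

end
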